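(* Let $B_{n,p}$ ($n,p\ge 0$) be the $p$-Bernoulli numbers. Then the bivariate generating function $$G(z,t)=\sum_{p\ge 0}\sum_{n\ge 0} B_{n,p}\,\frac{t^n}{n!}\,\frac{z^p}{p+1}$$ is given by $$G(z,t)=\frac{t+\log(1-z)}{e^t(1-z)-1}.$$
   Context: The Bernoulli numbers $B_n$ are defined by $\sum_{n\ge 0}B_n\frac{t^n}{n!}=\frac{t}{e^t-1}$. The $p$-Bernoulli numbers $B_{n,p}$, for integers $n,p\ge 0$, are the numbers satisfying $B_{0,p}=1$ for all $p\ge 0$, $B_{n,0}=B_n$ for all $n\ge 0$, and the recurrence relation $$B_{n+1,p}=p\,B_{n,p}-\frac{(p+1)^2}{p+2}\,B_{n,p+1},\qquad p\ge 0,\ n\ge 0.$$ Generating functions are understood as formal power series, with $\log(1-z)=-\sum_{k\ge 1}z^k/k$. The quotient $\frac{t+\log(1-z)}{e^t(1-z)-1}$ is the power series in $z$ and $t$ obtained by substituting $\xi=t+\log(1-z)$ into the power series $\frac{\xi}{e^{\xi}-1}=\sum_{n\ge0}B_n\frac{\xi^n}{n!}$. *)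

theory Defs
  imports Complex_Main "HOL-Computational_Algebra.Formal_Power_Series"
begin

unbundle fps_syntax

(* Both sides of the division have subdegree 1, so fps division is the true quotient. *)
definition bernoulli :: "nat \<Rightarrow> real" where
  "bernoulli n = fact n * (fps_X / (fps_exp 1 - 1)) $ n"

definition is_p_bernoulli :: "(nat \<Rightarrow> nat \<Rightarrow> real) \<Rightarrow> bool" where
  "is_p_bernoulli B \<longleftrightarrow>
     (\<forall>p. B 0 p = 1) \<and>
     (\<forall>n. B n 0 = bernoulli n) \<and>
     (\<forall>n p. B (Suc n) p = real p * B n p - (real p + 1)\<^sup>2 / (real p + 2) * B n (Suc p))"

(* Power series in z and t have type real fps fps: F $ p $ n is the coefficient of z^p t^n.
   Hence t is the constant series fps_const fps_X and z is the outer fps_X. *)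

definition log_one_minus_z :: "real fps fps" where
  "log_one_minus_z = Abs_fps (\<lambda>k. fps_const (if k = 0 then 0 else - 1 / real k))"

(* The substitution sum_k F_k \<xi>^k for a bivariate \<xi> without constant term. The library's oo
   only applies when the whole coefficient of z^0 vanishes, which fails for t + log(1 - z).
   The terms with k > p + n do not contribute to the coefficient of z^p t^n
   (fps_bivariate_power_nth_eq_0 below). *)
definition fps_subst2 :: "real fps \<Rightarrow> real fps fps \<Rightarrow> real fps fps" where
  "fps_subst2 F \<xi> = Abs_fps (\<lambda>p. Abs_fps (\<lambda>n. \<Sum>k\<le>p + n. F $ k * (\<xi> ^ k) $ p $ n))"

(* (t + log(1 - z)) / (e^t (1 - z) - 1), read as \<xi> / (e^\<xi> - 1) at \<xi> = t + log(1 - z). *)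
definition quotient_series :: "real fps fps" where
  "quotient_series =
     fps_subst2 (Abs_fps (\<lambda>n. bernoulli n / fact n)) (fps_const fps_X + log_one_minus_z)"

definition p_bernoulli_gf :: "(nat \<Rightarrow> nat \<Rightarrow> real) \<Rightarrow> real fps fps" where
  "p_bernoulli_gf B = Abs_fps (\<lambda>p. Abs_fps (\<lambda>n. B n p / fact n / (real p + 1)))"

lemma fps_bivariate_power_nth_eq_0:
  fixes \<xi> :: "real fps fps"
  assumes "\<xi> $ 0 $ 0 = 0" "p + n < k"
  shows "(\<xi> ^ k) $ p $ n = 0"
  using assms(2)
proof (induction k arbitrary: p n)
  case 0
  then show ?case by simp
next
  case (Suc k)
  have "\<xi> $ i $ j * (\<xi> ^ k) $ (p - i) $ (n - j) = 0" if "i \<le> p" "j \<le> n" for i j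
  proof (cases "i = 0 \<and> j = 0")
    case True
    then show ?thesis using assms(1) by simp
  next
    case False
    then have "(p - i) + (n - j) < k" using Suc.prems that by arith
    then show ?thesis using Suc.IH by simp
  qed
  then show ?case
    by (auto simp: fps_mult_nth fps_sum_nth simp del: mult_eq_0_iff intro!: sum.neutral)
qed

lemma quotient_series_argument_nth_0: "(fps_const fps_X + log_one_minus_z) $ 0 $ 0 = 0"
  by (simp add: log_one_minus_z_def)

lemma is_p_bernoulli_unique:
  assumes "is_p_bernoulli B" "is_p_bernoulli C"
  shows "B = C"
proof -
  have "B n p = C n p" for n p
    using assms by (induction n arbitrary: p) (simp_all add: is_p_bernoulli_def)
  then show ?thesis by blast
qed

lemma is_p_bernoulli_exists: "\<exists>B. is_p_bernoulli B"
proof -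
  define u :: "real fps" where "u = 1 - fps_exp 1"
  define c :: "nat \<Rightarrow> nat \<Rightarrow> real" where "c p k = fact k * fact (p + 1) / fact (p + k + 1)" for p k
  define f where "f p = Abs_fps (c p) oo u" for p
  define B where "B n p = fact n * f p $ n" for n p
  have u0: "u $ 0 = 0" by (simp add: u_def)
  have c1: "c p (Suc k) = c p k * (real k + 1) / (real p + real k + 2)" for p k
    by (simp add: c_def field_simps)
  have c2: "c (Suc p) k = c p k * (real p + 2) / (real p + real k + 2)" for p k
    by (simp add: c_def field_simps)
  have key: "(fps_X - 1) * fps_deriv (Abs_fps (c p)) =
      fps_const (real p) * Abs_fps (c p)
      - fps_const ((real p + 1)\<^sup>2 / (real p + 2)) * Abs_fps (c (Suc p))" for p
  proof (rule fps_ext)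
    fix k
    have "real k * c p k - (real k + 1) * c p (Suc k) =
        real p * c p k - (real p + 1)\<^sup>2 / (real p + 2) * c (Suc p) k"
      unfolding c1 c2 by (simp add: divide_simps) (simp add: algebra_simps power2_eq_square)
    then show "((fps_X - 1) * fps_deriv (Abs_fps (c p))) $ k =
        (fps_const (real p) * Abs_fps (c p)
         - fps_const ((real p + 1)\<^sup>2 / (real p + 2)) * Abs_fps (c (Suc p))) $ k"
      by (cases k) (simp_all add: algebra_simps)
  qed
  have rec: "fps_deriv (f p) =
      fps_const (real p) * f p - fps_const ((real p + 1)\<^sup>2 / (real p + 2)) * f (Suc p)" for p
  proof -
    have "fps_deriv (f p) = (fps_deriv (Abs_fps (c p)) oo u) * fps_deriv u"
      unfolding f_def by (rule fps_compose_deriv[OF u0])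
    also have "fps_deriv u = (fps_X - 1) oo u"
      using u0 by (simp add: u_def fps_compose_sub_distrib)
    also have "(fps_deriv (Abs_fps (c p)) oo u) * \<dots> =
        ((fps_X - 1) * fps_deriv (Abs_fps (c p))) oo u"
      by (simp add: fps_compose_mult_distrib[OF u0] mult.commute)
    finally show ?thesis
      by (simp add: key f_def fps_compose_sub_distrib fps_compose_mult_distrib[OF u0])
  qed
  have "B (Suc n) p = real p * B n p - (real p + 1)\<^sup>2 / (real p + 2) * B n (Suc p)" for n p
  proof -
    have "B (Suc n) p = fact n * fps_deriv (f p) $ n"
      by (simp add: B_def algebra_simps)
    then show ?thesis
      by (simp add: rec B_def algebra_simps)
  qed
  moreover have "B 0 p = 1" for p
    by (simp add: B_def f_def c_def)
  moreover have "B n 0 = bernoulli n" for n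
  proof -
    let ?e = "fps_exp 1 - 1 :: real fps"
    have e: "?e $ 0 = 0" "?e $ 1 \<noteq> 0" by simp_all
    have c0: "c 0 k = 1 / (real k + 1)" for k
      unfolding c_def by (simp add: add.commute)
    have "fps_X * Abs_fps (c 0) = - (fps_ln 1 oo (- fps_X))"
    proof (rule fps_ext)
      fix k
      show "(fps_X * Abs_fps (c 0)) $ k = (- (fps_ln 1 oo (- fps_X))) $ k"
        by (cases k) (simp_all add: fps_compose_uminus' fps_ln_nth c0 field_simps
                        flip: power_mult_distrib)
    qed
    then have "(fps_X * Abs_fps (c 0)) oo u = - ((fps_ln 1 oo (- fps_X)) oo u)"
      by (simp add: fps_compose_uminus)
    also have "(fps_ln 1 oo (- fps_X)) oo u = fps_ln 1 oo ((- fps_X) oo u)"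
      by (rule fps_compose_assoc[symmetric]) (simp_all add: u0)
    also have "(- fps_X) oo u = ?e"
      using u0 by (simp add: fps_compose_uminus) (simp add: u_def)
    also have "fps_ln 1 oo ?e = fps_X"
      using fps_inv[OF e] by (simp add: fps_ln_fps_exp_inv)
    finally have "u * f 0 = - fps_X"
      using u0 by (simp add: f_def fps_compose_mult_distrib)
    then have "f 0 * ?e = fps_X"
      by (simp add: u_def algebra_simps)
    moreover have "?e \<noteq> 0" using e(2) by (metis fps_zero_nth)
    ultimately have "f 0 = fps_X / ?e"
      by (metis nonzero_mult_div_cancel_right)
    then show ?thesis by (simp add: B_def bernoulli_def)
  qed
  ultimately show ?thesis unfolding is_p_bernoulli_def by blast
qed

end

theory Submission
  imports Defs
begin

text \<open>
  Write \<open>b\<^sub>p(t)\<close> for the coefficient of \<open>z^p\<close> in \<open>G(z,t)\<close>, which is the exponential generating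
  function of \<open>B\<^bsub>n,p\<^esub>\<close> in \<open>n\<close>, divided by \<open>p + 1\<close>. The division absorbs the factor
  \<open>(p + 1)\<^sup>2 / (p + 2)\<close>: after multiplying by \<open>t^n / n!\<close> and summing, the recurrence for the
  \<open>p\<close>-Bernoulli numbers becomes \<open>b\<^sub>p' = p b\<^sub>p - (p + 1) b\<^bsub>p+1\<^esub>\<close>. This is the transport equation
  \<open>\<partial>G/\<partial>t + (1 - z) \<partial>G/\<partial>z = 0\<close>, read off at \<open>z^p\<close> (lemma \<open>transport_p_bernoulli_gf\<close>).

  The left-hand side of that equation is a derivation and \<open>\<xi> = t + log (1 - z)\<close> lies in its
  kernel, because \<open>\<partial>\<xi>/\<partial>t = 1\<close> and \<open>(1 - z) \<partial>\<xi>/\<partial>z = -1\<close>. Hence it kills every power of \<open>\<xi>\<close>, and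
  so every power series in \<open>\<xi>\<close>, in particular \<open>\<xi> / (e^\<xi> - 1)\<close> (lemma \<open>transport_fps_subst2\<close>).

  Finally, a solution of the transport equation is determined by its value at \<open>z = 0\<close>, since the
  equation expresses the coefficient of \<open>z^(p+1)\<close> through that of \<open>z^p\<close> (lemma
  \<open>transport_eq_0_unique\<close>). At \<open>z = 0\<close> both sides are \<open>\<Sum>n. B\<^sub>n t^n / n!\<close>.
\<close>

definition fps_inner_deriv :: "'a::comm_semiring_1 fps fps \<Rightarrow> 'a fps fps" where
  "fps_inner_deriv F = Abs_fps (\<lambda>p. fps_deriv (F $ p))"

text \<open>
  The operator \<open>\<partial>/\<partial>t + (1 - z) \<partial>/\<partial>z\<close>; its characteristics are the curves
  \<open>t + log (1 - z) = const\<close>.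
\<close>

definition transport :: "'a::comm_ring_1 fps fps \<Rightarrow> 'a fps fps" where
  "transport F = fps_inner_deriv F + (1 - fps_X) * fps_deriv F"

lemma fps_inner_deriv_mult:
  "fps_inner_deriv (F * G) = fps_inner_deriv F * G + F * fps_inner_deriv G"
  by (rule fps_ext)
     (simp add: fps_inner_deriv_def fps_mult_nth fps_deriv_sum sum.distrib add.commute)

lemma transport_mult: "transport (F * G) = transport F * G + F * transport G"
  by (simp add: transport_def fps_inner_deriv_mult algebra_simps)

lemma transport_power_eq_0:
  assumes "transport F = 0"
  shows "transport (F ^ k) = 0"
proof (induction k)
  case 0
  show ?case
    by (simp add: transport_def fps_inner_deriv_def fps_eq_iff)
next
  case (Suc k)
  then show ?case
    using assms by (simp add: transport_mult)
qed

lemma transport_nth: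
  "transport F $ p $ n =
     of_nat (Suc n) * F $ p $ Suc n + of_nat (Suc p) * F $ Suc p $ n - of_nat p * F $ p $ n"
proof -
  have of_nat_mult_nth: "(of_nat m * f) $ n = of_nat m * f $ n" for m and f :: "'a fps"
    by (simp flip: fps_of_nat)
  have "transport F $ p = fps_deriv (F $ p) + of_nat (Suc p) * F $ Suc p - of_nat p * F $ p"
    by (cases p) (simp_all add: transport_def fps_inner_deriv_def left_diff_distrib)
  then show ?thesis
    by (simp add: of_nat_mult_nth del: of_nat_Suc)
qed

lemma transport_eq_0_unique:
  fixes F G :: "'a::field_char_0 fps fps"
  assumes "transport F = 0" "transport G = 0" "F $ 0 = G $ 0"
  shows "F = G"
proof (rule fps_ext)
  have step: "H $ Suc p $ n = (of_nat p * H $ p $ n - of_nat (Suc n) * H $ p $ Suc n) / of_nat (Suc p)"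
    if "transport H = 0" for H :: "'a fps fps" and p n
    using transport_nth[of H p n] that
    by (simp add: field_simps del: of_nat_Suc)
  show "F $ p = G $ p" for p
  proof (induction p)
    case (Suc p)
    then show ?case
      by (intro fps_ext) (simp only: step[OF assms(1)] step[OF assms(2)])
  qed (fact assms(3))
qed

text \<open>
  The number of summands in a coefficient of \<open>fps_subst2\<close> depends on the coefficient, whereas
  \<open>transport\<close> combines coefficients of different total degree. A common longer range of summation
  makes the operator act on the sum term by term.
\<close>

lemma fps_subst2_nth:
  assumes "\<xi> $ 0 $ 0 = 0" "p + n \<le> m"
  shows "fps_subst2 F \<xi> $ p $ n = (\<Sum>k\<le>m. F $ k * (\<xi> ^ k) $ p $ n)"
  unfolding fps_subst2_def fps_nth_Abs_fps
  using assms by (intro sum.mono_neutral_left) (auto simp: fps_bivariate_power_nth_eq_0)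

lemma transport_fps_subst2:
  assumes "\<xi> $ 0 $ 0 = 0" "transport \<xi> = 0"
  shows "transport (fps_subst2 F \<xi>) = 0"
proof -
  have "transport (fps_subst2 F \<xi>) $ p $ n = 0" for p n
  proof -
    have "transport (fps_subst2 F \<xi>) $ p $ n =
        (\<Sum>k\<le>Suc (p + n). F $ k * transport (\<xi> ^ k) $ p $ n)"
      by (simp add: transport_nth fps_subst2_nth[OF assms(1), where m = "Suc (p + n)"]
            sum_distrib_left sum.distrib sum_subtractf algebra_simps
          del: sum.atMost_Suc of_nat_Suc)
    also have "\<dots> = 0"
      by (simp add: transport_power_eq_0[OF assms(2)])
    finally show ?thesis .
  qed
  then show ?thesis
    by (simp add: fps_eq_iff)
qed

lemma transport_t_plus_log: "transport (fps_const fps_X + log_one_minus_z) = 0"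
proof -
  have "transport (fps_const fps_X + log_one_minus_z) $ p $ n = 0" for p n
    by (cases p) (auto simp: transport_nth log_one_minus_z_def)
  then show ?thesis
    by (simp add: fps_eq_iff)
qed

lemma fps_subst2_nth_0:
  assumes "\<xi> $ 0 = fps_X"
  shows "fps_subst2 F \<xi> $ 0 = F"
proof (rule fps_ext)
  fix n
  have "fps_subst2 F \<xi> $ 0 $ n = (\<Sum>k\<le>n. if k = n then F $ k else 0)"
    unfolding fps_subst2_def fps_nth_Abs_fps using assms
    by (intro sum.cong) (auto simp: fps_power_zeroth fps_X_power_nth)
  then show "fps_subst2 F \<xi> $ 0 $ n = F $ n"
    by simp
qed

lemma transport_p_bernoulli_gf:
  assumes "is_p_bernoulli B"
  shows "transport (p_bernoulli_gf B) = 0"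
proof -
  have "transport (p_bernoulli_gf B) $ p $ n = 0" for p n
  proof -
    have rec: "B (Suc n) p = real p * B n p - (real p + 1)\<^sup>2 / (real p + 2) * B n (Suc p)"
      using assms by (simp add: is_p_bernoulli_def)
    have "real (Suc n) * (B (Suc n) p / fact (Suc n) / (real p + 1)) =
        B (Suc n) p / (fact n * (real p + 1))"
      by (simp add: divide_simps del: of_nat_Suc)
    also have "\<dots> = real p * (B n p / fact n / (real p + 1)) -
        real (Suc p) * (B n (Suc p) / fact n / (real (Suc p) + 1))"
      unfolding rec by (simp add: divide_simps) (simp add: algebra_simps power2_eq_square)
    finally show ?thesis
      by (simp add: transport_nth p_bernoulli_gf_def del: of_nat_Suc fact_Suc)
  qed
  then show ?thesis
    by (simp add: fps_eq_iff)
qed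

theorem theorem2:
  fixes B :: "nat \<Rightarrow> nat \<Rightarrow> real"
  assumes "is_p_bernoulli B"
  shows "p_bernoulli_gf B = quotient_series"
proof (rule transport_eq_0_unique)
  show "transport (p_bernoulli_gf B) = 0"
    using assms by (rule transport_p_bernoulli_gf)
  show "transport quotient_series = 0"
    unfolding quotient_series_def
    by (rule transport_fps_subst2[OF quotient_series_argument_nth_0 transport_t_plus_log])
  have "(fps_const fps_X + log_one_minus_z) $ 0 = fps_X"
    by (simp add: log_one_minus_z_def)
  then have "quotient_series $ 0 = Abs_fps (\<lambda>n. bernoulli n / fact n)"
    unfolding quotient_series_def by (rule fps_subst2_nth_0)
  then show "p_bernoulli_gf B $ 0 = quotient_series $ 0"
    using assms by (simp add: p_bernoulli_gf_def is_p_bernoulli_def)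
qed

end
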